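(* The set of Gödel codes of $\omega$-true closed sentences is not recursively enumerable.
   Context: **Syntax.** Terms: $t::=v_i\mid\bot\mid\mathbf 0\mid\mathbf S t\mid t=t\mid\neg t\mid t\lor t\mid\lambda t\mid t\cdot t\mid\mathcal R\mid\mathcal A$ ($v_i$, $i\in\mathbb N$, de Bruijn variables; $\lambda$ is the only binder; application associates to the left). A closed sentence is a closed term. $\bot$ is a divergent constant, $\mathcal R$ the primitive recursor, $\mathcal A$ the universal quantifier. $\underline n=\mathbf S^n\mathbf 0$; $b[t]$ is the $\beta$-instance substituting $t$ for the outermost bound variable of $b$. Fix a standard Gödel coding of terms. **$\omega$-truth** (the $\omega$-completed semantics of the grounded arithmetic OGA). Let $\Downarrow$ be the least relation between closed terms and naturals such that: $\mathbf 0\Downarrow0$; $t\Downarrow n$ implies $\mathbf S t\Downarrow n+1$; if $t\Downarrow m$, $u\Downarrow n$ then $(t=u)\Downarrow1$ when $m=n$ and $(t=u)\Downarrow0$ when $m\ne n$; $t\Downarrow1$ implies $\neg t\Downarrow0$, and $t\Downarrow0$ implies $\neg t\Downarrow1$; $t\lor u\Downarrow1$ if $t\Downarrow1$ or $u\Downarrow1$, and $t\lor u\Downarrow0$ if $t\Downarrow0$ and $u\Downarrow0$; for any finite list of arguments $\vec s$: $b[t]\cdot\vec s\Downarrow n$ implies $(\lambda b)\cdot t\cdot\vec s\Downarrow n$; if $a\Downarrow0$ and $g\cdot\vec s\Downarrow n$ then $\mathcal R\cdot g\cdot h\cdot a\cdot\vec s\Downarrow n$; if $a\Downarrow k+1$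 and $h\cdot\underline k\cdot(\mathcal R\cdot g\cdot h\cdot\underline k)\cdot\vec s\Downarrow n$ then $\mathcal R\cdot g\cdot h\cdot a\cdot\vec s\Downarrow n$; $\mathcal A\cdot f\Downarrow1$ if $f\cdot\underline k\Downarrow1$ for all $k\in\mathbb N$; $\mathcal A\cdot f\Downarrow0$ if $f\cdot\underline k\Downarrow0$ for some $k$. A closed term $t$ is $\omega$-true if $t\Downarrow1$. *)

theory Defs
  imports Main "HOL-Library.Nat_Bijection"
begin

text \<open>De Bruijn terms; \<open>Var 0\<close> refers to the innermost enclosing \<open>Lam\<close>. \<open>Bot\<close> is the divergent
  constant, \<open>PrimRec\<close> is \<open>\<R>\<close> and \<open>Univ\<close> is \<open>\<A>\<close>; the latter two are constants, so
  \<open>Lam\<close> is the only binder.\<close>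

datatype trm =
    Var nat
  | Bot
  | Zero
  | Succ trm
  | Equal trm trm
  | Neg trm
  | Disj trm trm
  | Lam trm
  | App trm trm  (infixl "\<cdot>" 70)
  | PrimRec
  | Univ

fun closed_at :: "nat \<Rightarrow> trm \<Rightarrow> bool" where
  "closed_at k (Var i) \<longleftrightarrow> i < k"
| "closed_at k Bot \<longleftrightarrow> True"
| "closed_at k Zero \<longleftrightarrow> True"
| "closed_at k (Succ t) \<longleftrightarrow> closed_at k t"
| "closed_at k (Equal t u) \<longleftrightarrow> closed_at k t \<and> closed_at k u"
| "closed_at k (Neg t) \<longleftrightarrow> closed_at k t"
| "closed_at k (Disj t u) \<longleftrightarrow> closed_at k t \<and> closed_at k u"
| "closed_at k (Lam t) \<longleftrightarrow> closed_at (Suc k) t"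
| "closed_at k (t \<cdot> u) \<longleftrightarrow> closed_at k t \<and> closed_at k u"
| "closed_at k PrimRec \<longleftrightarrow> True"
| "closed_at k Univ \<longleftrightarrow> True"

abbreviation closed_trm :: "trm \<Rightarrow> bool" where
  "closed_trm t \<equiv> closed_at 0 t"

fun lift :: "nat \<Rightarrow> trm \<Rightarrow> trm" where
  "lift k (Var i) = (if i < k then Var i else Var (Suc i))"
| "lift k Bot = Bot"
| "lift k Zero = Zero"
| "lift k (Succ t) = Succ (lift k t)"
| "lift k (Equal t u) = Equal (lift k t) (lift k u)"
| "lift k (Neg t) = Neg (lift k t)"
| "lift k (Disj t u) = Disj (lift k t) (lift k u)"
| "lift k (Lam t) = Lam (lift (Suc k) t)"
| "lift k (t \<cdot> u) = lift k t \<cdot> lift k u"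
| "lift k PrimRec = PrimRec"
| "lift k Univ = Univ"

text \<open>\<open>subst k s t\<close> replaces index \<open>k\<close> in \<open>t\<close> by \<open>s\<close> and decrements the indices above \<open>k\<close>.\<close>

fun subst :: "nat \<Rightarrow> trm \<Rightarrow> trm \<Rightarrow> trm" where
  "subst k s (Var i) = (if i < k then Var i else if i = k then s else Var (i - 1))"
| "subst k s Bot = Bot"
| "subst k s Zero = Zero"
| "subst k s (Succ t) = Succ (subst k s t)"
| "subst k s (Equal t u) = Equal (subst k s t) (subst k s u)"
| "subst k s (Neg t) = Neg (subst k s t)"
| "subst k s (Disj t u) = Disj (subst k s t) (subst k s u)"
| "subst k s (Lam t) = Lam (subst (Suc k) (lift 0 s) t)"
| "subst k s (t \<cdot> u) = subst k s t \<cdot> subst k s u"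
| "subst k s PrimRec = PrimRec"
| "subst k s Univ = Univ"

definition beta_inst :: "trm \<Rightarrow> trm \<Rightarrow> trm" where
  "beta_inst b t = subst 0 t b"

fun numeral_trm :: "nat \<Rightarrow> trm" where
  "numeral_trm 0 = Zero"
| "numeral_trm (Suc n) = Succ (numeral_trm n)"

abbreviation apps :: "trm \<Rightarrow> trm list \<Rightarrow> trm" where
  "apps t ss \<equiv> foldl App t ss"

text \<open>The relation lives on closed terms. Closedness is a premise only in the rules whose
  conclusion is not already closed when the subjects of the other premises are; see
  \<open>evaluates_closed\<close>.\<close>

inductive evaluates :: "trm \<Rightarrow> nat \<Rightarrow> bool"  (infix "\<Down>" 50) where
  Zero: "Zero \<Down> 0"
| Succ: "t \<Down> n \<Longrightarrow> Succ t \<Down> Suc n"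
| Equal_true: "t \<Down> m \<Longrightarrow> u \<Down> n \<Longrightarrow> m = n \<Longrightarrow> Equal t u \<Down> 1"
| Equal_false: "t \<Down> m \<Longrightarrow> u \<Down> n \<Longrightarrow> m \<noteq> n \<Longrightarrow> Equal t u \<Down> 0"
| Neg_false: "t \<Down> 1 \<Longrightarrow> Neg t \<Down> 0"
| Neg_true: "t \<Down> 0 \<Longrightarrow> Neg t \<Down> 1"
| Disj_true_left: "t \<Down> 1 \<Longrightarrow> closed_trm u \<Longrightarrow> Disj t u \<Down> 1"
| Disj_true_right: "u \<Down> 1 \<Longrightarrow> closed_trm t \<Longrightarrow> Disj t u \<Down> 1"
| Disj_false: "t \<Down> 0 \<Longrightarrow> u \<Down> 0 \<Longrightarrow> Disj t u \<Down> 0"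
| Beta: "apps (beta_inst b t) ss \<Down> n \<Longrightarrow> closed_trm (Lam b) \<Longrightarrow> closed_trm t \<Longrightarrow>
    apps (Lam b \<cdot> t) ss \<Down> n"
| PrimRec_zero: "a \<Down> 0 \<Longrightarrow> apps g ss \<Down> n \<Longrightarrow> closed_trm h \<Longrightarrow>
    apps (PrimRec \<cdot> g \<cdot> h \<cdot> a) ss \<Down> n"
| PrimRec_Suc: "a \<Down> Suc k \<Longrightarrow>
    apps (h \<cdot> numeral_trm k \<cdot> (PrimRec \<cdot> g \<cdot> h \<cdot> numeral_trm k)) ss \<Down> n \<Longrightarrow>
    apps (PrimRec \<cdot> g \<cdot> h \<cdot> a) ss \<Down> n"
| Univ_true: "(\<And>k. f \<cdot> numeral_trm k \<Down> 1) \<Longrightarrow> Univ \<cdot> f \<Down> 1"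
| Univ_false: "f \<cdot> numeral_trm k \<Down> 0 \<Longrightarrow> Univ \<cdot> f \<Down> 0"

lemma closed_at_apps [simp]:
  "closed_at k (apps t ss) \<longleftrightarrow> closed_at k t \<and> (\<forall>s\<in>set ss. closed_at k s)"
  by (induction ss arbitrary: t) auto

lemma evaluates_closed: "t \<Down> n \<Longrightarrow> closed_trm t"
  by (induction rule: evaluates.induct) auto

definition omega_true :: "trm \<Rightarrow> bool" where
  "omega_true t \<longleftrightarrow> closed_trm t \<and> t \<Down> 1"

fun gcode :: "trm \<Rightarrow> nat" where
  "gcode (Var i) = prod_encode (0, i)"
| "gcode Bot = prod_encode (1, 0)"
| "gcode Zero = prod_encode (2, 0)"
| "gcode (Succ t) = prod_encode (3, gcode t)"
| "gcode (Equal t u) = prod_encode (4, prod_encode (gcode t, gcode u))"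
| "gcode (Neg t) = prod_encode (5, gcode t)"
| "gcode (Disj t u) = prod_encode (6, prod_encode (gcode t, gcode u))"
| "gcode (Lam t) = prod_encode (7, gcode t)"
| "gcode (t \<cdot> u) = prod_encode (8, prod_encode (gcode t, gcode u))"
| "gcode PrimRec = prod_encode (9, 0)"
| "gcode Univ = prod_encode (10, 0)"

lemma gcode_inject: "gcode t = gcode u \<Longrightarrow> t = u"
proof (induction t arbitrary: u)
qed (case_tac u; auto)+

text \<open>Codes for Kleene's partial recursive functions. \<open>RProj i\<close> is the \<open>i\<close>-th projection,
  counted from 0; \<open>RPrec f g\<close> recurses on the first argument; \<open>RMin f\<close> is unbounded
  minimisation over the first argument of \<open>f\<close>.\<close>

datatype recf =
    RZero
  | RSucc
  | RProj nat
  | RComp recf "recf list"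
  | RPrec recf recf
  | RMin recf

inductive has_arity :: "recf \<Rightarrow> nat \<Rightarrow> bool" where
  "has_arity RZero n"
| "has_arity RSucc 1"
| "i < n \<Longrightarrow> has_arity (RProj i) n"
| "has_arity f (length gs) \<Longrightarrow> (\<And>g. g \<in> set gs \<Longrightarrow> has_arity g n) \<Longrightarrow> has_arity (RComp f gs) n"
| "has_arity f n \<Longrightarrow> has_arity g (Suc (Suc n)) \<Longrightarrow> has_arity (RPrec f g) (Suc n)"
| "has_arity f (Suc n) \<Longrightarrow> has_arity (RMin f) n"

inductive computes :: "recf \<Rightarrow> nat list \<Rightarrow> nat \<Rightarrow> bool" where
  "computes RZero xs 0"
| "computes RSucc [x] (Suc x)"
| "i < length xs \<Longrightarrow> computes (RProj i) xs (xs ! i)"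
| "list_all2 (\<lambda>g y. computes g xs y) gs ys \<Longrightarrow> computes f ys z \<Longrightarrow> computes (RComp f gs) xs z"
| "computes f xs y \<Longrightarrow> computes (RPrec f g) (0 # xs) y"
| "computes (RPrec f g) (k # xs) r \<Longrightarrow> computes g (k # r # xs) y \<Longrightarrow>
    computes (RPrec f g) (Suc k # xs) y"
| "computes f (n # xs) 0 \<Longrightarrow> (\<And>i. i < n \<Longrightarrow> \<exists>y. computes f (i # xs) (Suc y)) \<Longrightarrow>
    computes (RMin f) xs n"

text \<open>A set is recursively enumerable if it is the domain of a unary partial recursive
  function.\<close>

definition recursively_enumerable :: "nat set \<Rightarrow> bool" where
  "recursively_enumerable A \<longleftrightarrow> (\<exists>f. has_arity f 1 \<and> A = {x. \<exists>y. computes f [x] y})"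

end

theory Submission
  imports Defs
begin

text \<open>All the connectives of \<open>\<omega>\<close>-truth are total on sentences with truth value 0 or 1,
  \<open>Univ\<close> included, so every arithmetical relation is decided by a sentence; recursion on the
  structure of a partial recursive function \<open>f\<close> shows that in particular its graph is. If the
  domain of \<open>f\<close> were the set of codes of \<open>\<omega>\<close>-true sentences, then a sentence \<open>D \<cdot> \<lceil>D\<rceil>\<close> saying
  that \<open>f\<close> diverges on the code of \<open>D \<cdot> \<lceil>D\<rceil>\<close> would be both true and false.\<close>

section \<open>Determinism\<close>

text \<open>Inverting \<open>evaluates\<close> on an application leaves equations between spines
  built by \<open>apps\<close>, which is no constructor. Comparing the heads and the flattened
  argument lists solves these equations.\<close>

fun spine_head :: "trm \<Rightarrow> trm" where
  "spine_head (t \<cdot> u) = spine_head t"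
| "spine_head t = t"

fun spine_args :: "trm \<Rightarrow> trm list" where
  "spine_args (t \<cdot> u) = spine_args t @ [u]"
| "spine_args t = []"

lemma spine_head_apps [simp]: "spine_head (apps t ss) = spine_head t"
  by (induction ss arbitrary: t) auto

lemma spine_args_apps [simp]: "spine_args (apps t ss) = spine_args t @ ss"
  by (induction ss arbitrary: t) auto

lemma apps_App_neq [simp]:
  "apps (t \<cdot> u) ss \<noteq> Zero" "apps (t \<cdot> u) ss \<noteq> Succ a" "apps (t \<cdot> u) ss \<noteq> Equal a b"
  "apps (t \<cdot> u) ss \<noteq> Neg a" "apps (t \<cdot> u) ss \<noteq> Disj a b"
  by (induction ss arbitrary: t u) auto

lemmas apps_App_neq_sym [simp] = apps_App_neq [symmetric]

inductive_cases evaluates_ZeroE: "Zero \<Down> n"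
inductive_cases evaluates_SuccE: "Succ t \<Down> n"
inductive_cases evaluates_EqualE: "Equal t u \<Down> n"
inductive_cases evaluates_NegE: "Neg t \<Down> n"
inductive_cases evaluates_DisjE: "Disj t u \<Down> n"

text \<open>A spine headed by an abstraction can only come from \<open>Beta\<close>: the head fixes
  \<open>b\<close> and excludes the other application rules, and the argument list fixes
  \<open>t\<close> and \<open>ss\<close>.\<close>

lemma evaluates_BetaD:
  assumes "apps (Lam b \<cdot> t) ss \<Down> n"
  shows "apps (beta_inst b t) ss \<Down> n"
  using assms
proof (cases rule: evaluates.cases)
  case (Beta b' t' ss')
  have "b' = b" "t' = t" "ss' = ss"
    using arg_cong[OF Beta(1), of spine_head] arg_cong[OF Beta(1), of spine_args] by auto
  with Beta(2) show ?thesis by simp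
qed (auto dest: arg_cong[where f = spine_head])

lemma evaluates_PrimRecD:
  assumes "apps (PrimRec \<cdot> g \<cdot> h \<cdot> a) ss \<Down> n"
  shows "a \<Down> 0 \<and> apps g ss \<Down> n \<or>
    (\<exists>k. a \<Down> Suc k \<and>
      apps (h \<cdot> numeral_trm k \<cdot> (PrimRec \<cdot> g \<cdot> h \<cdot> numeral_trm k)) ss \<Down> n)"
  using assms
proof (cases rule: evaluates.cases)
  case (PrimRec_zero a' g' ss' h')
  have "a' = a" "g' = g" "ss' = ss"
    using arg_cong[OF PrimRec_zero(1), of spine_args] by auto
  with PrimRec_zero(2,3) show ?thesis by simp
next
  case (PrimRec_Suc a' k h' g' ss')
  have "a' = a" "g' = g" "h' = h" "ss' = ss"
    using arg_cong[OF PrimRec_Suc(1), of spine_args] by auto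
  with PrimRec_Suc(2,3) show ?thesis by blast
qed (auto dest: arg_cong[where f = spine_head] arg_cong[where f = spine_args])

lemma evaluates_UnivD:
  assumes "Univ \<cdot> f \<Down> n"
  shows "(\<forall>k. f \<cdot> numeral_trm k \<Down> 1) \<and> n = 1 \<or> (\<exists>k. f \<cdot> numeral_trm k \<Down> 0) \<and> n = 0"
  using assms
  by (cases rule: evaluates.cases)
    (auto dest: arg_cong[where f = spine_head] arg_cong[where f = spine_args])

text \<open>Needed so that a sentence with value 0 cannot also be true. Where two rules compete, an
  induction hypothesis on a shared subterm decides: a disjunct, the recursion argument
  \<open>a\<close>, or an instance of the quantified \<open>f\<close>.\<close>

lemma evaluates_deterministic: "t \<Down> m \<Longrightarrow> t \<Down> n \<Longrightarrow> m = n"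
proof (induction arbitrary: n rule: evaluates.induct)
  case Zero
  then show ?case by (auto elim: evaluates_ZeroE)
next
  case (Succ t m)
  from Succ.prems show ?case by (rule evaluates_SuccE) (auto dest: Succ.IH)
next
  case (Equal_true t m u m')
  from Equal_true.prems show ?case
    by (rule evaluates_EqualE) (use Equal_true.hyps in \<open>auto dest: Equal_true.IH\<close>)
next
  case (Equal_false t m u m')
  from Equal_false.prems show ?case
    by (rule evaluates_EqualE) (use Equal_false.hyps in \<open>auto dest: Equal_false.IH\<close>)
next
  case (Neg_false t)
  from Neg_false.prems show ?case
    by (rule evaluates_NegE) (auto dest: Neg_false.IH)
next
  case (Neg_true t)
  from Neg_true.prems show ?case
    by (rule evaluates_NegE) (auto dest: Neg_true.IH)
next
  case (Disj_true_left t u)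
  from Disj_true_left.prems show ?case
    by (rule evaluates_DisjE) (auto dest: Disj_true_left.IH)
next
  case (Disj_true_right u t)
  from Disj_true_right.prems show ?case
    by (rule evaluates_DisjE) (auto dest: Disj_true_right.IH)
next
  case (Disj_false t u)
  from Disj_false.prems show ?case
    by (rule evaluates_DisjE) (auto dest: Disj_false.IH)
next
  case (Beta b t ss m)
  show ?case by (rule Beta.IH[OF evaluates_BetaD[OF Beta.prems]])
next
  case (PrimRec_zero a g ss m h)
  from evaluates_PrimRecD[OF PrimRec_zero.prems] PrimRec_zero.IH show ?case by blast
next
  case (PrimRec_Suc a k h g ss m)
  from evaluates_PrimRecD[OF PrimRec_Suc.prems] PrimRec_Suc.IH show ?case by blast
next
  case (Univ_true f)
  show ?case using evaluates_UnivD[OF Univ_true.prems] Univ_true.IH by metis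
next
  case (Univ_false f k)
  show ?case using evaluates_UnivD[OF Univ_false.prems] Univ_false.IH by metis
qed

section \<open>Truth tables\<close>

lemma evaluates_Neg_of_bool: "t \<Down> of_bool P \<Longrightarrow> Neg t \<Down> of_bool (\<not> P)"
  using evaluates.Neg_true[of t] evaluates.Neg_false[of t] by (cases P) auto

lemma evaluates_Disj_of_bool:
  assumes "t \<Down> of_bool P" "u \<Down> of_bool Q"
  shows "Disj t u \<Down> of_bool (P \<or> Q)"
  using assms evaluates.Disj_true_left[of t u] evaluates.Disj_true_right[of u t]
    evaluates.Disj_false[of t u] evaluates_closed[of t] evaluates_closed[of u]
  by (cases P; cases Q) auto

text \<open>The \<open>\<omega>\<close>-rule enters here: if all instances have truth values, so
  does the quantified sentence. Sentences thus go beyond what is recursively enumerable.\<close>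

lemma evaluates_Univ_of_bool:
  assumes "\<And>k. f \<cdot> numeral_trm k \<Down> of_bool (P k)"
  shows "Univ \<cdot> f \<Down> of_bool (\<forall>k. P k)"
proof (cases "\<forall>k. P k")
  case True
  then have "f \<cdot> numeral_trm k \<Down> 1" for k using assms[of k] by simp
  then show ?thesis using True by (simp add: evaluates.Univ_true del: One_nat_def)
next
  case False
  then obtain k where "\<not> P k" by blast
  then have "f \<cdot> numeral_trm k \<Down> 0" using assms[of k] by simp
  then show ?thesis using False by (auto intro: evaluates.Univ_false)
qed

section \<open>Substitution\<close>

lemma lift_closed: "closed_at j t \<Longrightarrow> j \<le> k \<Longrightarrow> lift k t = t"
  by (induction t arbitrary: j k) auto

lemma closed_at_lift: "closed_at k t \<Longrightarrow> closed_at (Suc k) (lift j t)"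
  by (induction t arbitrary: k j) auto

lemma subst_lift [simp]: "subst k s (lift k t) = t"
  by (induction t arbitrary: k s) auto

text \<open>The general commutation law has \<open>lift j s\<close> on the left; for closed
  \<open>s\<close> this is \<open>s\<close> itself.\<close>

lemma subst_Suc_lift:
  "closed_trm s \<Longrightarrow> j \<le> k \<Longrightarrow> subst (Suc k) s (lift j t) = lift j (subst k s t)"
  by (induction t arbitrary: j k) (auto simp: lift_closed)

lemma evaluates_numeral_trm: "numeral_trm n \<Down> n"
  by (induction n) (auto intro: evaluates.intros)

lemma closed_numeral_trm [simp]: "closed_at k (numeral_trm n)"
  by (induction n) auto

section \<open>Expressible functions\<close>

text \<open>\<open>expresses \<Phi> F\<close>: the term schema \<open>\<Phi>\<close>, in parameters \<open>\<sigma> i\<close> that may contain free variables,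
  computes \<open>F\<close> from their values. Commuting with substitution is what allows a parameter to be
  abstracted by \<open>Lam\<close> and instantiated again; no named variables are needed.\<close>

definition expresses :: "((nat \<Rightarrow> trm) \<Rightarrow> trm) \<Rightarrow> ((nat \<Rightarrow> nat) \<Rightarrow> nat) \<Rightarrow> bool" where
  "expresses \<Phi> F \<longleftrightarrow>
    (\<forall>k s \<sigma>. closed_trm s \<longrightarrow> subst k s (\<Phi> \<sigma>) = \<Phi> (\<lambda>i. subst k s (\<sigma> i))) \<and>
    (\<forall>k \<sigma>. (\<forall>i. closed_at k (\<sigma> i)) \<longrightarrow> closed_at k (\<Phi> \<sigma>)) \<and>
    (\<forall>\<sigma> \<rho>. (\<forall>i. \<sigma> i \<Down> \<rho> i) \<longrightarrow> \<Phi> \<sigma> \<Down> F \<rho>)"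

definition expressible :: "((nat \<Rightarrow> nat) \<Rightarrow> nat) \<Rightarrow> bool" where
  "expressible F \<longleftrightarrow> (\<exists>\<Phi>. expresses \<Phi> F)"

abbreviation expressible_pred :: "((nat \<Rightarrow> nat) \<Rightarrow> bool) \<Rightarrow> bool" where
  "expressible_pred P \<equiv> expressible (\<lambda>\<rho>. of_bool (P \<rho>))"

text \<open>The parameters as seen below one more \<open>Lam\<close>: the new variable is parameter
  0 and the old ones move up by one. Beta reduction then turns \<open>bind \<sigma>\<close> into
  \<open>case_nat s \<sigma>\<close>.\<close>

definition bind :: "(nat \<Rightarrow> trm) \<Rightarrow> nat \<Rightarrow> trm" where
  "bind \<sigma> = case_nat (Var 0) (\<lambda>i. lift 0 (\<sigma> i))"

lemma expressesI:
  assumes "\<And>k s \<sigma>. closed_trm s \<Longrightarrow> subst k s (\<Phi> \<sigma>) = \<Phi> (\<lambda>i. subst k s (\<sigma> i))"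
    and "\<And>k \<sigma>. (\<And>i. closed_at k (\<sigma> i)) \<Longrightarrow> closed_at k (\<Phi> \<sigma>)"
    and "\<And>\<sigma> \<rho>. (\<And>i. \<sigma> i \<Down> \<rho> i) \<Longrightarrow> \<Phi> \<sigma> \<Down> F \<rho>"
  shows "expresses \<Phi> F"
  using assms unfolding expresses_def by blast

lemma
  assumes "expresses \<Phi> F"
  shows expresses_subst: "closed_trm s \<Longrightarrow> subst k s (\<Phi> \<sigma>) = \<Phi> (\<lambda>i. subst k s (\<sigma> i))"
    and expresses_closed: "(\<And>i. closed_at k (\<sigma> i)) \<Longrightarrow> closed_at k (\<Phi> \<sigma>)"
    and expresses_evaluates: "(\<And>i. \<sigma> i \<Down> \<rho> i) \<Longrightarrow> \<Phi> \<sigma> \<Down> F \<rho>"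
  using assms unfolding expresses_def by blast+

lemma subst_bind:
  "closed_trm s \<Longrightarrow> (\<lambda>i. subst (Suc k) s (bind \<sigma> i)) = bind (\<lambda>i. subst k s (\<sigma> i))"
  by (auto simp: bind_def fun_eq_iff subst_Suc_lift split: nat.split)

lemma subst_0_bind: "(\<lambda>i. subst 0 s (bind \<sigma> i)) = case_nat s \<sigma>"
  by (auto simp: bind_def fun_eq_iff split: nat.split)

lemma closed_at_bind: "(\<And>i. closed_at k (\<sigma> i)) \<Longrightarrow> closed_at (Suc k) (bind \<sigma> i)"
  by (auto simp: bind_def closed_at_lift split: nat.split)

lemma evaluates_case_nat: "t \<Down> n \<Longrightarrow> (\<And>i. \<sigma> i \<Down> \<rho> i) \<Longrightarrow> case_nat t \<sigma> i \<Down> case_nat n \<rho> i"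
  by (cases i) auto

section \<open>Closure under connectives, quantifiers and recursion\<close>

lemma expressible_var [intro]: "expressible (\<lambda>\<rho>. \<rho> i)"
  unfolding expressible_def by (rule exI[of _ "\<lambda>\<sigma>. \<sigma> i"]) (auto intro: expressesI)

lemma expressible_zero [intro]: "expressible (\<lambda>\<rho>. 0)"
  unfolding expressible_def
  by (rule exI[of _ "\<lambda>\<sigma>. Zero"]) (auto intro: expressesI evaluates.intros)

lemma expressible_Suc [intro]:
  assumes "expressible F"
  shows "expressible (\<lambda>\<rho>. Suc (F \<rho>))"
proof -
  obtain \<Phi> where "expresses \<Phi> F" using assms unfolding expressible_def by blast
  then have "expresses (\<lambda>\<sigma>. Succ (\<Phi> \<sigma>)) (\<lambda>\<rho>. Suc (F \<rho>))"
    unfolding expresses_def by (auto intro: evaluates.intros)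
  then show ?thesis unfolding expressible_def by blast
qed

lemma expressible_eq [intro]:
  assumes "expressible F" "expressible G"
  shows "expressible_pred (\<lambda>\<rho>. F \<rho> = G \<rho>)"
proof -
  obtain \<Phi> \<Psi> where *: "expresses \<Phi> F" "expresses \<Psi> G"
    using assms unfolding expressible_def by blast
  have "expresses (\<lambda>\<sigma>. Equal (\<Phi> \<sigma>) (\<Psi> \<sigma>)) (\<lambda>\<rho>. of_bool (F \<rho> = G \<rho>))"
  proof (rule expressesI)
    fix \<sigma> :: "nat \<Rightarrow> trm" and \<rho> assume \<sigma>: "\<And>i. \<sigma> i \<Down> \<rho> i"
    have vals: "\<Phi> \<sigma> \<Down> F \<rho>" "\<Psi> \<sigma> \<Down> G \<rho>"
      by (rule expresses_evaluates[OF *(1)] expresses_evaluates[OF *(2)], rule \<sigma>)+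
    show "Equal (\<Phi> \<sigma>) (\<Psi> \<sigma>) \<Down> of_bool (F \<rho> = G \<rho>)"
      using evaluates.Equal_true[OF vals] evaluates.Equal_false[OF vals]
      by (cases "F \<rho> = G \<rho>") auto
  qed (simp_all add: expresses_subst[OF *(1)] expresses_subst[OF *(2)]
      expresses_closed[OF *(1)] expresses_closed[OF *(2)])
  then show ?thesis unfolding expressible_def by blast
qed

lemma expressible_not [intro]:
  assumes "expressible_pred P"
  shows "expressible_pred (\<lambda>\<rho>. \<not> P \<rho>)"
proof -
  obtain \<Phi> where *: "expresses \<Phi> (\<lambda>\<rho>. of_bool (P \<rho>))"
    using assms unfolding expressible_def by blast
  have "expresses (\<lambda>\<sigma>. Neg (\<Phi> \<sigma>)) (\<lambda>\<rho>. of_bool (\<not> P \<rho>))"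
  proof (rule expressesI)
    fix \<sigma> :: "nat \<Rightarrow> trm" and \<rho> assume \<sigma>: "\<And>i. \<sigma> i \<Down> \<rho> i"
    have vals: "\<Phi> \<sigma> \<Down> of_bool (P \<rho>)"
      by (rule expresses_evaluates[OF *], rule \<sigma>)
    show "Neg (\<Phi> \<sigma>) \<Down> of_bool (\<not> P \<rho>)"
      by (rule evaluates_Neg_of_bool[OF vals])
  qed (simp_all add: expresses_subst[OF *] expresses_closed[OF *])
  then show ?thesis unfolding expressible_def by blast
qed

lemma expressible_disj [intro]:
  assumes "expressible_pred P" "expressible_pred Q"
  shows "expressible_pred (\<lambda>\<rho>. P \<rho> \<or> Q \<rho>)"
proof -
  obtain \<Phi> \<Psi> where *: "expresses \<Phi> (\<lambda>\<rho>. of_bool (P \<rho>))" "expresses \<Psi> (\<lambda>\<rho>. of_bool (Q \<rho>))"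
    using assms unfolding expressible_def by blast
  have "expresses (\<lambda>\<sigma>. Disj (\<Phi> \<sigma>) (\<Psi> \<sigma>)) (\<lambda>\<rho>. of_bool (P \<rho> \<or> Q \<rho>))"
  proof (rule expressesI)
    fix \<sigma> :: "nat \<Rightarrow> trm" and \<rho> assume \<sigma>: "\<And>i. \<sigma> i \<Down> \<rho> i"
    have vals: "\<Phi> \<sigma> \<Down> of_bool (P \<rho>)" "\<Psi> \<sigma> \<Down> of_bool (Q \<rho>)"
      by (rule expresses_evaluates[OF *(1)] expresses_evaluates[OF *(2)], rule \<sigma>)+
    show "Disj (\<Phi> \<sigma>) (\<Psi> \<sigma>) \<Down> of_bool (P \<rho> \<or> Q \<rho>)"
      by (rule evaluates_Disj_of_bool[OF vals])
  qed (simp_all add: expresses_subst[OF *(1)] expresses_subst[OF *(2)]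
      expresses_closed[OF *(1)] expresses_closed[OF *(2)])
  then show ?thesis unfolding expressible_def by blast
qed

lemma expressible_conj [intro]:
  assumes "expressible_pred P" "expressible_pred Q"
  shows "expressible_pred (\<lambda>\<rho>. P \<rho> \<and> Q \<rho>)"
proof -
  have "expressible_pred (\<lambda>\<rho>. \<not> (\<not> P \<rho> \<or> \<not> Q \<rho>))"
    using assms by (intro expressible_not expressible_disj)
  then show ?thesis by simp
qed

text \<open>Gives access to the outer parameters below a quantifier, whose variable occupies index
  0.\<close>

lemma expressible_shift [intro]:
  assumes "expressible F"
  shows "expressible (\<lambda>\<rho>. F (\<lambda>i. \<rho> (Suc i)))"
proof -
  obtain \<Phi> where "expresses \<Phi> F" using assms unfolding expressible_def by blast
  then have "expresses (\<lambda>\<sigma>. \<Phi> (\<lambda>i. \<sigma> (Suc i))) (\<lambda>\<rho>. F (\<lambda>i. \<rho> (Suc i)))"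
    unfolding expresses_def by simp
  then show ?thesis unfolding expressible_def by blast
qed

text \<open>The quantified variable is parameter 0 of the matrix: \<open>bind\<close> makes room for
  it, \<open>Lam\<close> abstracts it, and \<open>Beta\<close> replaces it by each numeral in
  turn.\<close>

lemma expressible_all:
  assumes "expressible_pred (\<lambda>\<rho>. P (\<rho> 0) (\<lambda>i. \<rho> (Suc i)))"
  shows "expressible_pred (\<lambda>\<rho>. \<forall>y. P y \<rho>)"
proof -
  obtain \<Phi> where *: "expresses \<Phi> (\<lambda>\<rho>. of_bool (P (\<rho> 0) (\<lambda>i. \<rho> (Suc i))))"
    using assms unfolding expressible_def by blast
  have "expresses (\<lambda>\<sigma>. Univ \<cdot> Lam (\<Phi> (bind \<sigma>))) (\<lambda>\<rho>. of_bool (\<forall>y. P y \<rho>))"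
  proof (rule expressesI)
    fix k s and \<sigma> :: "nat \<Rightarrow> trm" assume "closed_trm s"
    then show "subst k s (Univ \<cdot> Lam (\<Phi> (bind \<sigma>))) =
        Univ \<cdot> Lam (\<Phi> (bind (\<lambda>i. subst k s (\<sigma> i))))"
      by (simp add: lift_closed expresses_subst[OF *] subst_bind)
  next
    fix k and \<sigma> :: "nat \<Rightarrow> trm" assume "\<And>i. closed_at k (\<sigma> i)"
    then show "closed_at k (Univ \<cdot> Lam (\<Phi> (bind \<sigma>)))"
      by (simp add: expresses_closed[OF *] closed_at_bind)
  next
    fix \<sigma> :: "nat \<Rightarrow> trm" and \<rho> assume \<sigma>: "\<And>i. \<sigma> i \<Down> \<rho> i"
    have "Lam (\<Phi> (bind \<sigma>)) \<cdot> numeral_trm y \<Down> of_bool (P y \<rho>)" for y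
    proof -
      have "\<Phi> (case_nat (numeral_trm y) \<sigma>) \<Down>
          of_bool (P (case_nat y \<rho> 0) (\<lambda>i. case_nat y \<rho> (Suc i)))"
        by (intro expresses_evaluates[OF *] evaluates_case_nat evaluates_numeral_trm \<sigma>)
      then have "beta_inst (\<Phi> (bind \<sigma>)) (numeral_trm y) \<Down> of_bool (P y \<rho>)"
        by (simp add: beta_inst_def expresses_subst[OF *] subst_0_bind)
      moreover have "closed_at (Suc 0) (\<Phi> (bind \<sigma>))"
        using \<sigma> by (intro expresses_closed[OF *] closed_at_bind evaluates_closed)
      ultimately show ?thesis
        using evaluates.Beta[where ss = "[]"] by simp
    qed
    then show "Univ \<cdot> Lam (\<Phi> (bind \<sigma>)) \<Down> of_bool (\<forall>y. P y \<rho>)"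
      by (rule evaluates_Univ_of_bool)
  qed
  then show ?thesis unfolding expressible_def by blast
qed

lemma expressible_ex:
  assumes "expressible_pred (\<lambda>\<rho>. P (\<rho> 0) (\<lambda>i. \<rho> (Suc i)))"
  shows "expressible_pred (\<lambda>\<rho>. \<exists>y. P y \<rho>)"
proof -
  have "expressible_pred (\<lambda>\<rho>. \<not> (\<forall>y. \<not> P y \<rho>))"
    using assms by (intro expressible_not expressible_all)
  then show ?thesis by simp
qed

lemma expressible_rec_nat:
  assumes "expressible A" "expressible N"
    and "expressible (\<lambda>\<rho>. G (\<rho> 1) (\<rho> 0) (\<lambda>i. \<rho> (Suc (Suc i))))"
  shows "expressible (\<lambda>\<rho>. rec_nat (A \<rho>) (\<lambda>k r. G k r \<rho>) (N \<rho>))"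
proof -
  obtain \<Phi> \<Psi> \<Gamma> where \<Phi>: "expresses \<Phi> A" and \<Psi>: "expresses \<Psi> N"
    and \<Gamma>: "expresses \<Gamma> (\<lambda>\<rho>. G (\<rho> 1) (\<rho> 0) (\<lambda>i. \<rho> (Suc (Suc i))))"
    using assms unfolding expressible_def by blast
  \<comment> \<open>\<open>PrimRec\<close> supplies the counter before the recursive result, so the
    inner variable, parameter 0, is \<open>r\<close> and parameter 1 is \<open>k\<close>.\<close>
  define step where "step \<sigma> = Lam (Lam (\<Gamma> (bind (bind \<sigma>))))" for \<sigma>
  have subst_step: "subst k s (step \<sigma>) = step (\<lambda>i. subst k s (\<sigma> i))" if "closed_trm s" for k s \<sigma>
    using that by (simp add: step_def lift_closed expresses_subst[OF \<Gamma>] subst_bind)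
  have closed_step: "closed_at k (step \<sigma>)" if "\<And>i. closed_at k (\<sigma> i)" for k \<sigma>
    using that by (simp add: step_def expresses_closed[OF \<Gamma>] closed_at_bind)
  have "expresses (\<lambda>\<sigma>. PrimRec \<cdot> \<Phi> \<sigma> \<cdot> step \<sigma> \<cdot> \<Psi> \<sigma>)
      (\<lambda>\<rho>. rec_nat (A \<rho>) (\<lambda>k r. G k r \<rho>) (N \<rho>))"
  proof (rule expressesI)
    fix \<sigma> :: "nat \<Rightarrow> trm" and \<rho> assume \<sigma>: "\<And>i. \<sigma> i \<Down> \<rho> i"
    have cl: "closed_trm (\<sigma> i)" for i using \<sigma> evaluates_closed by blast
    \<comment> \<open>Evaluation is by name: \<open>t\<close> will be the unevaluated recursive
      call, so it cannot be assumed to be a numeral.\<close>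
    have step: "step \<sigma> \<cdot> numeral_trm k \<cdot> t \<Down> G k r \<rho>" if t: "t \<Down> r" for k t r
    proof -
      have clt: "closed_trm t" using t evaluates_closed by blast
      have "\<Gamma> (case_nat t (case_nat (numeral_trm k) \<sigma>)) \<Down> G k r \<rho>"
        using expresses_evaluates[OF \<Gamma>, of "case_nat t (case_nat (numeral_trm k) \<sigma>)"
            "case_nat r (case_nat k \<rho>)"]
        by (simp add: evaluates_case_nat evaluates_numeral_trm \<sigma> t)
      then have "Lam (\<Gamma> (bind (case_nat (numeral_trm k) \<sigma>))) \<cdot> t \<Down> G k r \<rho>"
        using evaluates.Beta[where ss = "[]" and t = t
            and b = "\<Gamma> (bind (case_nat (numeral_trm k) \<sigma>))"]
        by (simp add: beta_inst_def clt cl expresses_subst[OF \<Gamma>] subst_0_bind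
            expresses_closed[OF \<Gamma>] closed_at_bind split: nat.split)
      then show ?thesis
        using evaluates.Beta[where ss = "[t]" and t = "numeral_trm k"
            and b = "Lam (\<Gamma> (bind (bind \<sigma>)))"]
        by (simp add: step_def beta_inst_def cl expresses_subst[OF \<Gamma>] subst_0_bind subst_bind
            expresses_closed[OF \<Gamma>] closed_at_bind lift_closed)
    qed
    have base: "\<Phi> \<sigma> \<Down> A \<rho>" by (intro expresses_evaluates[OF \<Phi>] \<sigma>)
    have rec: "PrimRec \<cdot> \<Phi> \<sigma> \<cdot> step \<sigma> \<cdot> a \<Down> rec_nat (A \<rho>) (\<lambda>k r. G k r \<rho>) n" if "a \<Down> n" for a n
      using that
    proof (induction n arbitrary: a rule: nat_induct)
      case 0
      then show ?case
        using evaluates.PrimRec_zero[where ss = "[]"] base by (simp add: closed_step cl)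
    next
      case (Suc n)
      show ?case
        using evaluates.PrimRec_Suc[OF Suc.prems, where ss = "[]"]
          step[OF Suc.IH[OF evaluates_numeral_trm], of n] by simp
    qed
    show "PrimRec \<cdot> \<Phi> \<sigma> \<cdot> step \<sigma> \<cdot> \<Psi> \<sigma> \<Down> rec_nat (A \<rho>) (\<lambda>k r. G k r \<rho>) (N \<rho>)"
      by (intro rec expresses_evaluates[OF \<Psi>] \<sigma>)
  qed (auto simp: expresses_subst[OF \<Phi>] expresses_subst[OF \<Psi>] subst_step closed_step
      expresses_closed[OF \<Phi>] expresses_closed[OF \<Psi>])
  then show ?thesis unfolding expressible_def by blast
qed

text \<open>Recursion at a higher type: what is carried along is the predicate of the possible values
  so far, since the value itself may be undefined.\<close>

lemma expressible_rec_pred: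
  assumes "expressible_pred (\<lambda>\<rho>. P (\<rho> 0) (\<lambda>i. \<rho> (Suc i)))"
    and "expressible N" "expressible Y"
    and "expressible_pred (\<lambda>\<rho>. Q (\<rho> 2) (\<rho> 0) (\<rho> 1) (\<lambda>i. \<rho> (Suc (Suc (Suc i)))))"
  shows "expressible_pred
    (\<lambda>\<rho>. rec_nat (\<lambda>y. P y \<rho>) (\<lambda>k R y. \<exists>r. R r \<and> Q k r y \<rho>) (N \<rho>) (Y \<rho>))"
proof -
  obtain \<Phi> \<Psi> \<Theta> \<Gamma> where \<Phi>: "expresses \<Phi> (\<lambda>\<rho>. of_bool (P (\<rho> 0) (\<lambda>i. \<rho> (Suc i))))"
    and \<Psi>: "expresses \<Psi> N" and \<Theta>: "expresses \<Theta> Y"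
    and \<Gamma>: "expresses \<Gamma> (\<lambda>\<rho>. of_bool (Q (\<rho> 2) (\<rho> 0) (\<rho> 1) (\<lambda>i. \<rho> (Suc (Suc (Suc i))))))"
    using assms unfolding expressible_def by blast
  \<comment> \<open>Parameter 2 of \<open>body\<close> is the predicate \<open>R\<close>; it has no numerical value and must be kept away
    from \<open>\<Gamma>\<close>.\<close>
  define skip where "skip \<sigma> i = (if i < 2 then \<sigma> i else \<sigma> (Suc i))" for \<sigma> :: "nat \<Rightarrow> trm" and i
  define base where "base \<sigma> = Lam (\<Phi> (bind \<sigma>))" for \<sigma>
  \<comment> \<open>This negates the conjunction under the existential quantifier. Parameters 0 to 3
    are \<open>r\<close>, \<open>y\<close>, \<open>R\<close>, \<open>k\<close>; skipping
    \<open>R\<close> leaves them in the order \<open>r\<close>, \<open>y\<close>, \<open>k\<close>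
    that \<open>\<Gamma>\<close> expects.\<close>
  define body where "body \<sigma> = Disj (Neg (\<sigma> 2 \<cdot> \<sigma> 0)) (Neg (\<Gamma> (skip \<sigma>)))" for \<sigma>
  define exbody where "exbody \<sigma> = Neg (Univ \<cdot> Lam (body (bind \<sigma>)))" for \<sigma>
  define step where "step \<sigma> = Lam (Lam (Lam (exbody (bind (bind (bind \<sigma>))))))" for \<sigma>
  have subst_base: "subst k s (base \<sigma>) = base (\<lambda>i. subst k s (\<sigma> i))" if "closed_trm s" for k s \<sigma>
    using that by (simp add: base_def lift_closed expresses_subst[OF \<Phi>] subst_bind)
  have closed_base: "closed_at k (base \<sigma>)" if "\<And>i. closed_at k (\<sigma> i)" for k \<sigma>
    using that by (simp add: base_def expresses_closed[OF \<Phi>] closed_at_bind)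
  have subst_skip: "(\<lambda>i. subst k s (skip \<sigma> i)) = skip (\<lambda>i. subst k s (\<sigma> i))" for k s \<sigma>
    by (auto simp: skip_def)
  have subst_body: "subst k s (body \<sigma>) = body (\<lambda>i. subst k s (\<sigma> i))" if "closed_trm s" for k s \<sigma>
    using that by (simp add: body_def expresses_subst[OF \<Gamma>] subst_skip)
  have closed_body: "closed_at k (body \<sigma>)" if "\<And>i. closed_at k (\<sigma> i)" for k \<sigma>
    using that by (simp add: body_def expresses_closed[OF \<Gamma>] skip_def)
  have subst_exbody: "subst k s (exbody \<sigma>) = exbody (\<lambda>i. subst k s (\<sigma> i))"
    if "closed_trm s" for k s \<sigma>
    using that by (simp add: exbody_def subst_body subst_bind lift_closed)
  have closed_exbody: "closed_at k (exbody \<sigma>)" if "\<And>i. closed_at k (\<sigma> i)" for k \<sigma>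
    using that by (simp add: exbody_def closed_body closed_at_bind)
  have subst_step: "subst k s (step \<sigma>) = step (\<lambda>i. subst k s (\<sigma> i))" if "closed_trm s" for k s \<sigma>
    using that by (simp add: step_def lift_closed subst_exbody subst_bind)
  have closed_step: "closed_at k (step \<sigma>)" if "\<And>i. closed_at k (\<sigma> i)" for k \<sigma>
    using that by (simp add: step_def closed_exbody closed_at_bind)
  have "expresses (\<lambda>\<sigma>. PrimRec \<cdot> base \<sigma> \<cdot> step \<sigma> \<cdot> \<Psi> \<sigma> \<cdot> \<Theta> \<sigma>)
    (\<lambda>\<rho>. of_bool (rec_nat (\<lambda>y. P y \<rho>) (\<lambda>k R y. \<exists>r. R r \<and> Q k r y \<rho>) (N \<rho>) (Y \<rho>)))"
  proof (rule expressesI)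
    fix \<sigma> :: "nat \<Rightarrow> trm" and \<rho> assume \<sigma>: "\<And>i. \<sigma> i \<Down> \<rho> i"
    have cl: "closed_trm (\<sigma> i)" for i using \<sigma> evaluates_closed by blast
    have base: "base \<sigma> \<cdot> t \<Down> of_bool (P y \<rho>)" if t: "t \<Down> y" for t y
    proof -
      have clt: "closed_trm t" using t evaluates_closed by blast
      have "\<Phi> (case_nat t \<sigma>) \<Down> of_bool (P y \<rho>)"
        using expresses_evaluates[OF \<Phi>, of "case_nat t \<sigma>" "case_nat y \<rho>"]
        by (simp add: evaluates_case_nat \<sigma> t)
      then show ?thesis
        using evaluates.Beta[where ss = "[]" and t = t and b = "\<Phi> (bind \<sigma>)"]
        by (simp add: base_def beta_inst_def clt cl expresses_subst[OF \<Phi>] subst_0_bind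
            expresses_closed[OF \<Phi>] closed_at_bind)
    qed
    \<comment> \<open>The term \<open>T\<close> represents the predicate \<open>R\<close>. It is
      only substituted and applied, so it needs to be closed but needs no value of its own.\<close>
    have step: "step \<sigma> \<cdot> numeral_trm k \<cdot> T \<cdot> t \<Down> of_bool (\<exists>r. R r \<and> Q k r y \<rho>)"
      if t: "t \<Down> y" and T: "closed_trm T" "\<And>u r. u \<Down> r \<Longrightarrow> T \<cdot> u \<Down> of_bool (R r)"
      for k t y T R
    proof -
      have clt: "closed_trm t" using t evaluates_closed by blast
      define \<tau> where "\<tau> = case_nat t (case_nat T (case_nat (numeral_trm k) \<sigma>))"
      have cl\<tau>: "closed_trm (\<tau> i)" for i
        by (simp add: \<tau>_def clt T cl split: nat.split)
      have inst: "Lam (body (bind \<tau>)) \<cdot> numeral_trm r \<Down> of_bool (\<not> (R r \<and> Q k r y \<rho>))" for r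
      proof -
        have "T \<cdot> numeral_trm r \<Down> of_bool (R r)" by (rule T evaluates_numeral_trm)+
        moreover have "\<Gamma> (skip (case_nat (numeral_trm r) \<tau>)) \<Down> of_bool (Q k r y \<rho>)"
        proof -
          have "skip (case_nat (numeral_trm r) \<tau>) =
              case_nat (numeral_trm r) (case_nat t (case_nat (numeral_trm k) \<sigma>))"
            by (auto simp: skip_def \<tau>_def fun_eq_iff numeral_2_eq_2 split: nat.split)
          then show ?thesis
            using expresses_evaluates[OF \<Gamma>, of "skip (case_nat (numeral_trm r) \<tau>)"
                "case_nat r (case_nat y (case_nat k \<rho>))"]
            by (simp add: evaluates_case_nat evaluates_numeral_trm \<sigma> t numeral_2_eq_2)
        qed
        moreover have "case_nat (numeral_trm r) \<tau> 2 = T"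
          by (simp add: \<tau>_def numeral_2_eq_2)
        ultimately have "body (case_nat (numeral_trm r) \<tau>) \<Down> of_bool (\<not> (R r \<and> Q k r y \<rho>))"
          unfolding body_def de_Morgan_conj
          by (intro evaluates_Disj_of_bool evaluates_Neg_of_bool) simp_all
        then show ?thesis
          using evaluates.Beta[where ss = "[]" and t = "numeral_trm r" and b = "body (bind \<tau>)"]
          by (simp add: beta_inst_def cl\<tau> subst_body subst_0_bind closed_body closed_at_bind)
      qed
      have ex: "exbody \<tau> \<Down> of_bool (\<exists>r. R r \<and> Q k r y \<rho>)"
        using evaluates_Neg_of_bool[OF evaluates_Univ_of_bool[OF inst]] by (simp add: exbody_def)
      \<comment> \<open>The three arguments are abstracted again from the innermost outwards, one
        \<open>Beta\<close> each; those already abstracted form the list \<open>ss\<close>.\<close>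
      have "Lam (exbody (bind (case_nat T (case_nat (numeral_trm k) \<sigma>)))) \<cdot> t
          \<Down> of_bool (\<exists>r. R r \<and> Q k r y \<rho>)"
        using evaluates.Beta[where ss = "[]" and t = t
            and b = "exbody (bind (case_nat T (case_nat (numeral_trm k) \<sigma>)))"] ex
        by (simp add: beta_inst_def clt cl T subst_exbody subst_0_bind \<tau>_def
            closed_exbody closed_at_bind split: nat.split)
      then have "Lam (Lam (exbody (bind (bind (case_nat (numeral_trm k) \<sigma>))))) \<cdot> T \<cdot> t
          \<Down> of_bool (\<exists>r. R r \<and> Q k r y \<rho>)"
        using evaluates.Beta[where ss = "[t]" and t = T
            and b = "Lam (exbody (bind (bind (case_nat (numeral_trm k) \<sigma>))))"]
        by (simp add: beta_inst_def cl T subst_exbody subst_0_bind subst_bind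
            closed_exbody closed_at_bind lift_closed split: nat.split)
      then show ?thesis
        using evaluates.Beta[where ss = "[T, t]" and t = "numeral_trm k"
            and b = "Lam (Lam (exbody (bind (bind (bind \<sigma>)))))"]
        by (simp add: step_def beta_inst_def cl subst_exbody subst_0_bind subst_bind
            closed_exbody closed_at_bind lift_closed)
    qed
    \<comment> \<open>The induction generalizes over \<open>t\<close> and \<open>y\<close>, because
      the predicate at stage \<open>n\<close> is queried at every candidate
      \<open>r\<close>.\<close>
    have rec: "PrimRec \<cdot> base \<sigma> \<cdot> step \<sigma> \<cdot> a \<cdot> t \<Down>
        of_bool (rec_nat (\<lambda>y. P y \<rho>) (\<lambda>k R y. \<exists>r. R r \<and> Q k r y \<rho>) n y)"
      if "a \<Down> n" "t \<Down> y" for a n t y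
      using that
    proof (induction n arbitrary: a t y rule: nat_induct)
      case 0
      then show ?case
        using evaluates.PrimRec_zero[where ss = "[t]" and g = "base \<sigma>" and h = "step \<sigma>"]
          base[of t y] by (simp add: closed_step cl)
    next
      case (Suc n)
      \<comment> \<open>The recursive call without its last argument plays the role of
        \<open>T\<close>.\<close>
      have "step \<sigma> \<cdot> numeral_trm n \<cdot> (PrimRec \<cdot> base \<sigma> \<cdot> step \<sigma> \<cdot> numeral_trm n) \<cdot> t \<Down>
          of_bool (rec_nat (\<lambda>y. P y \<rho>) (\<lambda>k R y. \<exists>r. R r \<and> Q k r y \<rho>) (Suc n) y)"
        unfolding nat.rec(2)
        by (rule step[OF Suc.prems(2)])
          (use Suc.IH[OF evaluates_numeral_trm] in \<open>auto simp: closed_base closed_step cl\<close>)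
      then show ?case
        using evaluates.PrimRec_Suc[OF Suc.prems(1), where ss = "[t]"] by simp
    qed
    show "PrimRec \<cdot> base \<sigma> \<cdot> step \<sigma> \<cdot> \<Psi> \<sigma> \<cdot> \<Theta> \<sigma> \<Down> of_bool (rec_nat (\<lambda>y. P y \<rho>)
      (\<lambda>k R y. \<exists>r. R r \<and> Q k r y \<rho>) (N \<rho>) (Y \<rho>))"
      by (intro rec expresses_evaluates[OF \<Psi>] expresses_evaluates[OF \<Theta>] \<sigma>)
  qed (auto simp: expresses_subst[OF \<Psi>] expresses_subst[OF \<Theta>] subst_base subst_step closed_step
      closed_base expresses_closed[OF \<Psi>] expresses_closed[OF \<Theta>])
  then show ?thesis unfolding expressible_def by blast
qed

section \<open>Arithmetic and Goedel coding\<close>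

lemma expressible_add [intro]:
  assumes "expressible F" "expressible G"
  shows "expressible (\<lambda>\<rho>. F \<rho> + G \<rho>)"
proof -
  have "expressible (\<lambda>\<rho>. rec_nat (F \<rho>) (\<lambda>k r. Suc r) (G \<rho>))"
    using assms by (intro expressible_rec_nat) auto
  moreover have "rec_nat m (\<lambda>k r. Suc r) n = m + n" for m n
    by (induction n) auto
  ultimately show ?thesis by simp
qed

lemma expressible_less [intro]:
  assumes "expressible F" "expressible G"
  shows "expressible_pred (\<lambda>\<rho>. F \<rho> < G \<rho>)"
proof -
  have "expressible_pred (\<lambda>\<rho>. \<exists>d. G \<rho> = Suc (F \<rho> + d))"
    using assms by (intro expressible_ex expressible_eq expressible_Suc expressible_add
        expressible_shift expressible_var)
  then show ?thesis by (simp add: less_iff_Suc_add)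
qed

lemma expressible_const [intro]: "expressible (\<lambda>\<rho>. c)"
  by (induction c) auto

lemma expressible_prod_encode [intro]:
  assumes "expressible F" "expressible G"
  shows "expressible (\<lambda>\<rho>. prod_encode (F \<rho>, G \<rho>))"
proof -
  have "expressible (\<lambda>\<rho>. rec_nat 0 (\<lambda>k r. r + Suc k) (F \<rho> + G \<rho>) + F \<rho>)"
    using assms by (intro expressible_add expressible_rec_nat) auto
  moreover have "rec_nat 0 (\<lambda>k r. r + Suc k) n = triangle n" for n
    by (induction n) auto
  ultimately show ?thesis by (simp add: prod_encode_def)
qed

text \<open>Self-reference requires computing the code of a numeral from its value; the tags 2 and 3
  are those of \<open>Zero\<close> and \<open>Succ\<close>.\<close>

lemma expressible_gcode_numeral_trm [intro]:
  assumes "expressible F"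
  shows "expressible (\<lambda>\<rho>. gcode (numeral_trm (F \<rho>)))"
proof -
  have "expressible (\<lambda>\<rho>. rec_nat (prod_encode (2, 0)) (\<lambda>k r. prod_encode (3, r)) (F \<rho>))"
    using assms by (intro expressible_rec_nat) auto
  moreover have "rec_nat (prod_encode (2, 0)) (\<lambda>k r. prod_encode (3, r)) n =
      gcode (numeral_trm n)" for n
    by (induction n) auto
  ultimately show ?thesis by simp
qed

section \<open>Graphs of partial recursive functions\<close>

inductive_cases computes_RZeroE: "computes RZero xs y"
inductive_cases computes_RSuccE: "computes RSucc xs y"
inductive_cases computes_RProjE: "computes (RProj i) xs y"
inductive_cases computes_RCompE: "computes (RComp f gs) xs y"
inductive_cases computes_RPrec_0E: "computes (RPrec f g) (0 # xs) y"
inductive_cases computes_RPrec_SucE: "computes (RPrec f g) (Suc k # xs) y"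
inductive_cases computes_RMinE: "computes (RMin f) xs y"

lemma computes_RZero_iff: "computes RZero xs y \<longleftrightarrow> y = 0"
  by (auto elim: computes_RZeroE intro: computes.intros)

lemma computes_RSucc_iff: "computes RSucc [x] y \<longleftrightarrow> y = Suc x"
  by (auto elim: computes_RSuccE intro: computes.intros)

lemma computes_RProj_iff: "i < length xs \<Longrightarrow> computes (RProj i) xs y \<longleftrightarrow> y = xs ! i"
  by (auto elim: computes_RProjE intro: computes.intros)

lemma computes_RComp_iff: "computes (RComp f gs) xs y \<longleftrightarrow>
    (\<exists>ys. list_all2 (\<lambda>g y. computes g xs y) gs ys \<and> computes f ys y)"
  by (blast elim: computes_RCompE intro: computes.intros)

text \<open>Primitive recursion on possibly undefined values becomes a total iteration on
  predicates, the form treated by \<open>expressible_rec_pred\<close>.\<close>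

lemma computes_RPrec_iff: "computes (RPrec f g) (k # xs) y \<longleftrightarrow>
    rec_nat (computes f xs) (\<lambda>k R y. \<exists>r. R r \<and> computes g (k # r # xs) y) k y"
proof (induction k arbitrary: y)
  case 0
  then show ?case by (auto elim: computes_RPrec_0E intro: computes.intros)
next
  case (Suc k)
  then show ?case by (auto elim!: computes_RPrec_SucE intro: computes.intros)
qed

text \<open>The bounded implication is spelled with negation and disjunction to fit the closure
  lemmas.\<close>

lemma computes_RMin_iff: "computes (RMin f) xs n \<longleftrightarrow>
    computes f (n # xs) 0 \<and> (\<forall>i. \<not> i < n \<or> (\<exists>y. computes f (i # xs) (Suc y)))"
  by (auto elim: computes_RMinE intro!: computes.intros)

definition shift_params :: "((nat \<Rightarrow> nat) \<Rightarrow> nat) \<Rightarrow> (nat \<Rightarrow> nat) \<Rightarrow> nat" where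
  "shift_params X = (\<lambda>\<rho>. X (\<lambda>i. \<rho> (Suc i)))"

lemma expressible_shift_params: "expressible X \<Longrightarrow> expressible (shift_params X)"
  unfolding shift_params_def by (rule expressible_shift)

text \<open>The graph is a total predicate even where \<open>f\<close> diverges. The arguments are
  arbitrary expressible functions, since the induction inserts quantified variables and shifts the
  other arguments past them.\<close>

lemma expressible_computes:
  assumes "has_arity f n" "length Xs = n" "\<And>X. X \<in> set Xs \<Longrightarrow> expressible X" "expressible Y"
  shows "expressible_pred (\<lambda>\<rho>. computes f (map (\<lambda>X. X \<rho>) Xs) (Y \<rho>))"
  using assms
proof (induction arbitrary: Xs Y rule: has_arity.induct)
  case (1 n)
  then show ?case by (auto simp: computes_RZero_iff)
next
  case 2
  then show ?case by (auto simp: length_Suc_conv computes_RSucc_iff intro!: expressible_eq expressible_Suc)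
next
  case (3 i n)
  then show ?case by (auto simp: computes_RProj_iff)
next
  case (4 f gs n)
  \<comment> \<open>The quantifier over lists is unfolded into one number quantifier per inner
    function: \<open>Zs\<close> collects the values already chosen, \<open>hs\<close> the functions
    still to be treated.\<close>
  have "expressible_pred (\<lambda>\<rho>. \<exists>ys. list_all2 (\<lambda>g y. computes g (map (\<lambda>X. X \<rho>) Xs) y) hs ys \<and>
      computes f (map (\<lambda>Z. Z \<rho>) Zs @ ys) (Y \<rho>))"
    if "set hs \<subseteq> set gs" "length Zs + length hs = length gs" "length Xs = n"
      "\<And>X. X \<in> set Xs \<Longrightarrow> expressible X" "\<And>Z. Z \<in> set Zs \<Longrightarrow> expressible Z" "expressible Y"
    for hs Zs Xs Y
    using that
  proof (induction hs arbitrary: Zs Xs Y)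
    case Nil
    then show ?case using "4.IH"(1)[of Zs Y] by simp
  next
    case (Cons h hs)
    have "expressible_pred (\<lambda>\<rho>. computes h (map (\<lambda>X. X \<rho>) (map shift_params Xs)) (\<rho> 0))"
      using Cons.prems by (intro "4.IH"(2)) (auto intro: expressible_shift_params)
    moreover have "expressible_pred (\<lambda>\<rho>. \<exists>ys.
        list_all2 (\<lambda>g y. computes g (map (\<lambda>X. X \<rho>) (map shift_params Xs)) y) hs ys \<and>
        computes f (map (\<lambda>Z. Z \<rho>) (map shift_params Zs @ [\<lambda>\<rho>. \<rho> 0]) @ ys) (shift_params Y \<rho>))"
      using Cons.prems by (intro Cons.IH) (auto intro: expressible_shift_params)
    ultimately have "expressible_pred (\<lambda>\<rho>. \<exists>y. computes h (map (\<lambda>X. X \<rho>) Xs) y \<and> (\<exists>ys.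
        list_all2 (\<lambda>g y. computes g (map (\<lambda>X. X \<rho>) Xs) y) hs ys \<and>
        computes f (map (\<lambda>Z. Z \<rho>) Zs @ y # ys) (Y \<rho>)))"
      by (intro expressible_ex expressible_conj) (simp_all add: comp_def shift_params_def)
    then show ?case by (simp add: list_all2_Cons1 ex_simps[symmetric] conj_assoc del: ex_simps)
  qed
  from this[of gs "[]" Xs Y] "4.prems" show ?case by (simp add: computes_RComp_iff)
next
  case (5 f n g)
  from "5.prems" obtain K Zs where Xs: "Xs = K # Zs" and len: "length Zs = n"
    by (auto simp: length_Suc_conv)
  let ?Zs' = "map shift_params Zs"
  let ?Zs'' = "map (\<lambda>Z. shift_params (shift_params (shift_params Z))) Zs"
  have "expressible_pred (\<lambda>\<rho>. computes f (map (\<lambda>X. X \<rho>) ?Zs') (\<rho> 0))"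
    using "5.prems" len by (intro "5.IH"(1)) (auto simp: Xs intro: expressible_shift_params)
  \<comment> \<open>Indices 2, 0, 1 stand for the counter, the previous value and the new value; the
    remaining arguments are shifted past all three.\<close>
  moreover have "expressible_pred (\<lambda>\<rho>.
      computes g (map (\<lambda>X. X \<rho>) ((\<lambda>\<rho>. \<rho> 2) # (\<lambda>\<rho>. \<rho> 0) # ?Zs'')) (\<rho> 1))"
    using "5.prems" len by (intro "5.IH"(2)) (auto simp: Xs intro: expressible_shift_params)
  ultimately have "expressible_pred (\<lambda>\<rho>. rec_nat (\<lambda>y. computes f (map (\<lambda>X. X \<rho>) Zs) y)
      (\<lambda>k R y. \<exists>r. R r \<and> computes g (k # r # map (\<lambda>X. X \<rho>) Zs) y) (K \<rho>) (Y \<rho>))"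
    using "5.prems"
    by (intro expressible_rec_pred) (simp_all add: Xs comp_def shift_params_def)
  then show ?case by (simp add: Xs computes_RPrec_iff)
next
  case (6 f n)
  let ?Xs' = "map shift_params Xs"
  let ?Xs'' = "map (\<lambda>X. shift_params (shift_params X)) Xs"
  have "expressible_pred (\<lambda>\<rho>. computes f (map (\<lambda>X. X \<rho>) (Y # Xs)) 0)"
    using "6.prems" by (intro "6.IH") auto
  \<comment> \<open>Index 0 is the inner variable \<open>y\<close> and index 1 the outer variable
    \<open>i\<close>, hence the double shift.\<close>
  moreover have "expressible_pred (\<lambda>\<rho>.
      computes f (map (\<lambda>X. X \<rho>) ((\<lambda>\<rho>. \<rho> 1) # ?Xs'')) (Suc (\<rho> 0)))"
    using "6.prems" by (intro "6.IH") (auto intro: expressible_shift_params)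
  ultimately have "expressible_pred (\<lambda>\<rho>. computes f (Y \<rho> # map (\<lambda>X. X \<rho>) Xs) 0 \<and>
      (\<forall>i. \<not> i < Y \<rho> \<or> (\<exists>y. computes f (i # map (\<lambda>X. X \<rho>) Xs) (Suc y))))"
    using "6.prems"(3)
    by (intro expressible_conj expressible_all expressible_disj expressible_not expressible_less
        expressible_ex) (auto simp: comp_def shift_params_def)
  then show ?case by (simp add: computes_RMin_iff)
qed

section \<open>Diagonalization\<close>

theorem mainTheorem6:
  "\<not> recursively_enumerable {gcode t | t. closed_trm t \<and> omega_true t}"
proof
  assume "recursively_enumerable {gcode t | t. closed_trm t \<and> omega_true t}"
  then obtain f where f: "has_arity f 1"
    and dom: "{gcode t | t. closed_trm t \<and> omega_true t} = {x. \<exists>y. computes f [x] y}"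
    unfolding recursively_enumerable_def by blast
  \<comment> \<open>The tag 8 is that of application: if \<open>d\<close> codes \<open>D\<close>,
    this is the code of \<open>D \<cdot> numeral_trm d\<close>.\<close>
  let ?diag = "\<lambda>d. prod_encode (8, prod_encode (d, gcode (numeral_trm d)))"
  \<comment> \<open>Index 0 is reserved for the output of \<open>f\<close>, which is quantified away
    below; \<open>d\<close> then becomes parameter 0.\<close>
  have "expressible (\<lambda>\<rho>. ?diag (\<rho> 1))"
    by (intro expressible_prod_encode expressible_gcode_numeral_trm expressible_const
        expressible_var)
  then have "expressible_pred (\<lambda>\<rho>. computes f (map (\<lambda>X. X \<rho>) [\<lambda>\<rho>. ?diag (\<rho> 1)]) (\<rho> 0))"
    by (intro expressible_computes[OF f]) auto
  then have "expressible_pred (\<lambda>\<rho>. \<not> (\<exists>y. computes f [?diag (\<rho> 0)] y))"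
    by (intro expressible_not expressible_ex) simp
  then obtain \<Phi> where \<Phi>: "expresses \<Phi> (\<lambda>\<rho>. of_bool (\<not> (\<exists>y. computes f [?diag (\<rho> 0)] y)))"
    unfolding expressible_def by blast
  \<comment> \<open>The predicate depends on parameter 0 only, so every parameter may be sent to the
    bound variable; this makes \<open>D\<close> closed.\<close>
  define D where "D = Lam (\<Phi> (\<lambda>_. Var 0))"
  define G where "G = D \<cdot> numeral_trm (gcode D)"
  have "closed_trm D"
    unfolding D_def by (simp add: expresses_closed[OF \<Phi>])
  have "\<Phi> (\<lambda>_. numeral_trm (gcode D)) \<Down> of_bool (\<not> (\<exists>y. computes f [gcode G] y))"
    using expresses_evaluates[OF \<Phi>, of "\<lambda>_. numeral_trm (gcode D)" "\<lambda>_. gcode D"]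
    by (simp add: evaluates_numeral_trm G_def)
  then have G: "G \<Down> of_bool (\<not> (\<exists>y. computes f [gcode G] y))"
    using evaluates.Beta[where ss = "[]" and b = "\<Phi> (\<lambda>_. Var 0)" and t = "numeral_trm (gcode D)"]
      \<open>closed_trm D\<close>
    by (simp add: G_def D_def beta_inst_def expresses_subst[OF \<Phi>])
  have "(\<exists>y. computes f [gcode G] y) \<longleftrightarrow> (\<exists>t. gcode G = gcode t \<and> closed_trm t \<and> omega_true t)"
    using dom by blast
  also have "\<dots> \<longleftrightarrow> G \<Down> 1"
    using gcode_inject evaluates_closed unfolding omega_true_def by metis
  \<comment> \<open>If \<open>f\<close> halts on \<open>gcode G\<close>, then \<open>G\<close> has
    value 0, and determinism rules out value 1.\<close>
  also have "\<dots> \<longleftrightarrow> \<not> (\<exists>y. computes f [gcode G] y)"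
    using G evaluates_deterministic[OF G, of 1] by (cases "\<exists>y. computes f [gcode G] y") auto
  finally show False by blast
qed

end
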